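(* Let $\boldsymbol{a}=(a_n)_{n\ge1}$ be the sequence of Schur parameters of a probability measure $\mu$ on $\mathbb{T}$ with infinite support and let $\boldsymbol{u}=(u_n)_{n\ge1}$ be a sequence in $\mathbb{T}$. Then $\underline{\lim}_n\Sigma_n(\boldsymbol{a};\boldsymbol{u})$ coincides with $\mathrm{supp}\,\mu$ except, at most, at one point (that is, $\mathrm{supp}\,\mu\subset\underline{\lim}_n\Sigma_n(\boldsymbol{a};\boldsymbol{u})$ and the difference has at most one point). If this point exists, then $\overline{\overline{\lim}}_n\Sigma_n(\boldsymbol{a};\boldsymbol{u})=\underline{\lim}_n\Sigma_n(\boldsymbol{a};\boldsymbol{u})$ and, thus, $\overline{\overline{\lim}}_n\Sigma_n(\boldsymbol{a};\boldsymbol{u})$ equals $\mathrm{supp}\,\mu$ up to such a point.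
   Context: $\mathbb{T}=\{z\in\mathbb{C}:|z|=1\}$. Let $(\varphi_n)_{n\ge0}$ be the orthonormal polynomials in $L^2_\mu$, $\varphi_n(z)=\kappa_n(z^n+\cdots+a_n)$, $\kappa_n>0$; $a_n$ ($n\ge1$) are the Schur parameters of $\mu$, $|a_n|<1$. For a polynomial $p$ of degree $n$, $p^*(z):=z^n\overline p(z^{-1})$ ($\overline p$ has the conjugated coefficients). For $u\in\mathbb{T}$, $p_n^u(z):=z\varphi_{n-1}(z)+u\varphi_{n-1}^*(z)$ (para-orthogonal polynomial), and $\Sigma_n(\boldsymbol{a};\boldsymbol{u}):=\{z\in\mathbb{C}:p_n^{u_n}(z)=0\}$. For a sequence $(E_n)_{n\ge1}$ of subsets of $\mathbb{C}$, with $d$ the distance from a point to a set: $\underline{\lim}_nE_n:=\{\lambda\in\mathbb{C}:\lim_nd(\lambda,E_n)=0\}$ (strong limit points); $\overline{\overline{\lim}}_nE_n$ (double limit points) is the set of $\lambda\in\mathbb{C}$ such that for some infinite set $\mathcal{I}\subset\mathbb{N}$, $\lim_{n\in\mathcal{I}}d(\lambda,E_n)=\lim_{n\in\mathcal{I}}d(\lambda,E_{n+1})=0$. *)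

theory Defs
  imports
    "HOL-Probability.Probability"
    "HOL-Computational_Algebra.Computational_Algebra"
begin

definition prob_on_circle :: "complex measure \<Rightarrow> bool" where
  "prob_on_circle M \<longleftrightarrow>
     prob_space M \<and> sets M = sets (restrict_space borel (sphere (0::complex) 1))"

definition measure_supp :: "complex measure \<Rightarrow> complex set" where
  "measure_supp M =
     {z \<in> space M. \<forall>U. open U \<and> z \<in> U \<longrightarrow> emeasure M (U \<inter> space M) > 0}"

definition orthonormal_polys :: "complex measure \<Rightarrow> (nat \<Rightarrow> complex poly) \<Rightarrow> bool" where
  "orthonormal_polys M \<phi> \<longleftrightarrow>
     (\<forall>n. degree (\<phi> n) = n \<and> (\<exists>\<kappa>::real. \<kappa> > 0 \<and> lead_coeff (\<phi> n) = of_real \<kappa>)) \<and>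
     (\<forall>m n. (LINT z|M. poly (\<phi> n) z * cnj (poly (\<phi> m) z)) = (if m = n then 1 else 0))"

text \<open>The convention here is \<open>\<phi>\<^sub>n(z) = \<kappa>\<^sub>n (z\<^sup>n + \<dots> + a\<^sub>n)\<close>, with no sign or conjugation,
  so \<open>a\<^sub>n\<close> is the constant coefficient of the monic polynomial.\<close>

definition schur_parameters :: "(nat \<Rightarrow> complex poly) \<Rightarrow> (nat \<Rightarrow> complex) \<Rightarrow> bool" where
  "schur_parameters \<phi> a \<longleftrightarrow> (\<forall>n\<ge>1. a n = coeff (\<phi> n) 0 / lead_coeff (\<phi> n))"

text \<open>The reversal is taken at the actual degree of \<open>p\<close>:
  \<open>poly (reversed_poly p) z = z ^ degree p * cnj (poly p (1 / cnj z))\<close> for \<open>z \<noteq> 0\<close>.\<close>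

definition reversed_poly :: "complex poly \<Rightarrow> complex poly" where
  "reversed_poly p = reflect_poly (map_poly cnj p)"

definition para_orth_poly :: "(nat \<Rightarrow> complex poly) \<Rightarrow> nat \<Rightarrow> complex \<Rightarrow> complex poly" where
  "para_orth_poly \<phi> n u = pCons 0 (\<phi> (n - 1)) + smult u (reversed_poly (\<phi> (n - 1)))"

text \<open>Only the indices \<open>n \<ge> 1\<close> are meaningful; the limit sets below do not depend on the
  value at \<open>n = 0\<close>. The Schur parameters enter through \<open>\<phi>\<close>, which they determine.\<close>

definition para_orth_zeros ::
    "(nat \<Rightarrow> complex poly) \<Rightarrow> (nat \<Rightarrow> complex) \<Rightarrow> nat \<Rightarrow> complex set" where
  "para_orth_zeros \<phi> u n = {z. poly (para_orth_poly \<phi> n (u n)) z = 0}"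

text \<open>Since \<open>infdist x {} = 0\<close>, the next two definitions have their intended meaning for nonempty
  sets only; lemma \<open>para_orth_zeros_nonempty\<close> shows that this is the case here.\<close>

definition strong_limit_points :: "(nat \<Rightarrow> complex set) \<Rightarrow> complex set" where
  "strong_limit_points E = {x. (\<lambda>n. infdist x (E n)) \<longlonglongrightarrow> 0}"

definition double_limit_points :: "(nat \<Rightarrow> complex set) \<Rightarrow> complex set" where
  "double_limit_points E =
     {x. \<exists>I::nat set. infinite I \<and>
           ((\<lambda>n. infdist x (E n)) \<longlongrightarrow> 0) (inf sequentially (principal I)) \<and>
           ((\<lambda>n. infdist x (E (n + 1))) \<longlongrightarrow> 0) (inf sequentially (principal I))}"

lemma poly_reversed_poly:
  assumes "z \<noteq> 0"
  shows "poly (reversed_poly p) z = z ^ degree p * cnj (poly p (1 / cnj z))"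
proof -
  have d: "degree (map_poly cnj p) = degree p"
    by (rule degree_map_poly) simp
  have c: "poly (map_poly cnj p) w = cnj (poly p (cnj w))" for w
    by (simp add: poly_altdef d coeff_map_poly)
  show ?thesis
    using assms by (simp add: reversed_poly_def poly_reflect_poly_nz d c inverse_eq_divide)
qed

lemma para_orth_zeros_nonempty:
  assumes "orthonormal_polys M \<phi>"
  shows "para_orth_zeros \<phi> u n \<noteq> {}"
proof -
  let ?p = "\<phi> (n - 1)"
  let ?q = "para_orth_poly \<phi> n (u n)"
  have d: "degree ?p = n - 1"
    using assms by (simp add: orthonormal_polys_def)
  obtain \<kappa> :: real where "\<kappa> > 0" "lead_coeff ?p = of_real \<kappa>"
    using assms unfolding orthonormal_polys_def by blast
  then have nz: "?p \<noteq> 0"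
    by auto
  have "degree (map_poly cnj ?p) = n - 1"
    using d by (simp add: degree_map_poly)
  then have "degree (smult (u n) (reversed_poly ?p)) < degree (pCons 0 ?p)"
    using degree_reflect_poly_le[of "map_poly cnj ?p"] degree_smult_le[of "u n" "reversed_poly ?p"] nz d
    by (simp add: reversed_poly_def)
  then have "degree ?q = Suc (n - 1)"
    using nz d by (simp add: para_orth_poly_def degree_add_eq_left)
  then have "\<not> constant (poly ?q)"
    by (simp add: constant_degree)
  then show ?thesis
    using fundamental_theorem_of_algebra[of ?q] by (auto simp: para_orth_zeros_def)
qed

end

theory Submission
  imports Defs
begin

text \<open>
  Write \<open>\<phi>\<^sub>m\<^sup>*\<close> for the reversed polynomial and \<open>p = z \<phi>\<^sub>m + u \<phi>\<^sub>m\<^sup>*\<close> with \<open>\<bar>u\<bar> = 1\<close>. The polynomial \<open>p\<close>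
  is orthogonal to \<open>z, \<dots>, z\<^sup>m\<close>, and everything rests on one consequence of this
  (\<open>para_quotient_reproducing\<close>): if \<open>y\<close> is a zero of \<open>p\<close> on the circle, then the quotient
  \<open>q\<^sub>y = p / (z - y)\<close> represents evaluation at \<open>y\<close>,
  \<open>\<langle>f, q\<^sub>y\<rangle> = f(y) / \<phi>\<^sub>m(y)\<close> for all \<open>f\<close> of degree at most \<open>m\<close>.
  The use of \<open>q\<^sub>y\<close> in place of the Christoffel-Darboux kernel has the advantage that its norm is
  visibly at most \<open>2 / d\<close> when \<open>y\<close> has distance \<open>d\<close> from the support of the measure.

  Support points attract zeros. The zeros of \<open>p\<close> are \<open>m + 1\<close> distinct points of the circle, and the
  quotients \<open>q\<^sub>y\<close> belonging to them are pairwise orthogonal. Expanding \<open>g\<close> and \<open>1\<close> in this basis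
  shows that the mean square of a polynomial \<open>g\<close> of degree at most \<open>m\<close> is bounded by the maximum of
  \<open>\<bar>g\<bar>\<^sup>2\<close> on the zeros (\<open>norm2_le_on_para_zeros\<close>). A polynomial with a sharp peak at a support point
  \<open>w\<close> violates this bound if all zeros keep away from \<open>w\<close> and \<open>m\<close> is large enough to admit its degree.

  Outside the support there is room for one limit point only. The zeros of \<open>p\<close> on the circle are the
  points where the phase \<open>b\<^sub>m = z \<phi>\<^sub>m / \<phi>\<^sub>m\<^sup>*\<close> takes the value \<open>-u\<close>. Computing the inner product of two
  quotients \<open>q\<^sub>x, q\<^sub>y\<close>, taken from para-orthogonal polynomials with different \<open>u\<close>, gives
  \<open>\<bar>b\<^sub>m(x) - b\<^sub>m(y)\<bar> = \<bar>x - y\<bar> \<bar>\<langle>q\<^sub>x, q\<^sub>y\<rangle>\<bar> \<le> 4 / d\<^sup>2 \<bar>x - y\<bar>\<close>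
  for \<open>x, y\<close> at distance at least \<open>d\<close> from the support, uniformly in \<open>m\<close>
  (\<open>phase_Lipschitz_off_support\<close>). On the other hand the Szego recurrence makes \<open>b\<^sub>m\<^sub>+\<^sub>1(x) / x\<close> a
  function of \<open>b\<^sub>m(x)\<close> alone (\<open>phase_Suc_eq\<close>). Now let \<open>v, w\<close> lie off the support and let zeros at two
  consecutive levels \<open>m, m + 1\<close> accumulate at both. The zeros \<open>x\<close> near \<open>v\<close> and \<open>y\<close> near \<open>w\<close> of the lower level share
  the value of \<open>b\<^sub>m\<close>, so \<open>b\<^sub>m\<^sub>+\<^sub>1(x) / x = b\<^sub>m\<^sub>+\<^sub>1(y) / y\<close>; the zeros of the higher level share the value of
  \<open>b\<^sub>m\<^sub>+\<^sub>1\<close>, and the Lipschitz bound carries this over to \<open>b\<^sub>m\<^sub>+\<^sub>1(x) \<approx> b\<^sub>m\<^sub>+\<^sub>1(y)\<close>. Hence \<open>x \<approx> y\<close> and \<open>v = w\<close>.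
  Applied to a strong and a double limit point, this yields both the uniqueness of the exceptional
  point and the description of the double limit points.
\<close>

section \<open>The inner product of polynomials on the circle\<close>

locale circle_measure =
  fixes M :: "complex measure"
  assumes prob_on_circle: "prob_on_circle M"
begin

sublocale prob_space M
  using prob_on_circle by (simp add: prob_on_circle_def)

lemma sets_M: "sets M = sets (restrict_space borel (sphere (0::complex) 1))"
  using prob_on_circle by (simp add: prob_on_circle_def)

lemma space_M: "space M = sphere 0 1"
  using sets_eq_imp_space_eq[OF sets_M] by (simp add: space_restrict_space)

lemma integrable_continuous:
  fixes f :: "complex \<Rightarrow> 'b::{banach,second_countable_topology}"
  assumes "continuous_on (sphere 0 1) f"
  shows "integrable M f"
proof -
  have "compact (f ` sphere 0 1)"
    using assms by (intro compact_continuous_image) auto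
  then obtain B where "\<And>z. z \<in> sphere 0 1 \<Longrightarrow> norm (f z) \<le> B"
    by (meson bounded_iff compact_imp_bounded imageI)
  moreover have "f \<in> borel_measurable M"
    using borel_measurable_continuous_on_restrict[OF assms] measurable_cong_sets[OF sets_M refl] by auto
  ultimately show ?thesis
    by (intro integrable_const_bound[where B = B]) (auto simp: space_M)
qed

definition ip :: "complex poly \<Rightarrow> complex poly \<Rightarrow> complex" where
  "ip f g = (LINT z|M. poly f z * cnj (poly g z))"

definition norm2 :: "complex poly \<Rightarrow> real" where
  "norm2 f = (LINT z|M. (norm (poly f z))\<^sup>2)"

lemma integrable_ip: "integrable M (\<lambda>z. poly f z * cnj (poly g z))"
  by (intro integrable_continuous continuous_intros)

lemma integrable_norm2: "integrable M (\<lambda>z. (norm (poly f z))\<^sup>2)"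
  by (intro integrable_continuous continuous_intros)

lemma ip_add_left: "ip (f + g) h = ip f h + ip g h"
  unfolding ip_def by (simp add: distrib_right integrable_ip)

lemma ip_diff_left: "ip (f - g) h = ip f h - ip g h"
  unfolding ip_def by (simp add: left_diff_distrib integrable_ip)

lemma ip_smult_left: "ip (smult c f) h = c * ip f h"
  unfolding ip_def by (simp add: mult.assoc)

lemma ip_zero_left [simp]: "ip 0 h = 0"
  unfolding ip_def by simp

lemma ip_sum_left: "ip (sum f A) h = (\<Sum>i\<in>A. ip (f i) h)"
  by (induction A rule: infinite_finite_induct) (auto simp: ip_add_left)

lemma ip_commute: "ip g f = cnj (ip f g)"
proof -
  have "cnj (ip f g) = (LINT z|M. cnj (poly f z * cnj (poly g z)))"
    unfolding ip_def by (simp only: Bochner_Integration.integral_cnj)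
  then show ?thesis
    by (simp add: ip_def mult.commute)
qed

lemma ip_sum_right: "ip h (sum f A) = (\<Sum>i\<in>A. ip h (f i))"
  using arg_cong[OF ip_sum_left[of f A h], of cnj] by (simp flip: ip_commute)

lemma ip_smult_right: "ip f (smult c h) = cnj c * ip f h"
  using arg_cong[OF ip_smult_left[of c h f], of cnj] by (simp flip: ip_commute)

lemma ip_self: "ip f f = of_real (norm2 f)"
  unfolding ip_def norm2_def
  by (subst integral_complex_of_real[symmetric]) (simp only: complex_norm_square)

lemma norm2_nonneg: "norm2 f \<ge> 0"
  unfolding norm2_def by simp

text \<open>The arithmetic mean replaces the geometric mean of the Cauchy-Schwarz inequality; nothing is
  lost below, where both factors satisfy the same bound.\<close>

lemma norm_ip_le: "norm (ip f g) \<le> (norm2 f + norm2 g) / 2"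
proof -
  have "norm (ip f g) \<le> (LINT z|M. norm (poly f z * cnj (poly g z)))"
    unfolding ip_def by (rule integral_norm_bound)
  also have "\<dots> \<le> (LINT z|M. ((norm (poly f z))\<^sup>2 + (norm (poly g z))\<^sup>2) / 2)"
  proof (rule integral_mono)
    fix z
    show "norm (poly f z * cnj (poly g z)) \<le> ((norm (poly f z))\<^sup>2 + (norm (poly g z))\<^sup>2) / 2"
      using sum_squares_bound[of "norm (poly f z)" "norm (poly g z)"] by (simp add: norm_mult)
  qed (use integrable_norm2 integrable_ip in auto)
  also have "\<dots> = (norm2 f + norm2 g) / 2"
    unfolding norm2_def by (simp add: integrable_norm2)
  finally show ?thesis .
qed

lemma ip_cong:
  assumes "\<And>z. norm z = 1 \<Longrightarrow> poly f z * cnj (poly g z) = c * (poly h z * cnj (poly k z))"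
  shows "ip f g = c * ip h k"
proof -
  have "ip f g = (LINT z|M. c * (poly h z * cnj (poly k z)))"
    unfolding ip_def by (rule Bochner_Integration.integral_cong) (use assms in \<open>auto simp: space_M\<close>)
  then show ?thesis
    by (simp add: ip_def)
qed

lemma ip_pCons_pCons: "ip (pCons 0 f) (pCons 0 g) = ip f g"
proof -
  have "poly (pCons 0 f) z * cnj (poly (pCons 0 g) z) = 1 * (poly f z * cnj (poly g z))"
    if "norm z = 1" for z
  proof -
    have "z * cnj z = 1"
      using that by (simp add: complex_norm_square[symmetric])
    then show ?thesis
      by (simp add: algebra_simps)
  qed
  from ip_cong[OF this] show ?thesis by simp
qed

lemma ip_eq_0_if_orth_monoms:
  assumes "\<And>i. i < n \<Longrightarrow> ip f (monom 1 i) = 0" and "\<And>i. i \<ge> n \<Longrightarrow> coeff g i = 0"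
  shows "ip f g = 0"
proof -
  have "degree g \<le> n"
    by (intro degree_le) (use assms in auto)
  then have "ip f g = (\<Sum>i\<le>n. ip f (monom (coeff g i) i))"
    by (subst poly_as_sum_of_monoms'[symmetric, of g n]) (simp_all add: ip_sum_right)
  also have "\<dots> = (\<Sum>i\<le>n. cnj (coeff g i) * ip f (monom 1 i))"
    by (simp flip: ip_smult_right add: smult_monom)
  also have "\<dots> = 0"
    using assms by (intro sum.neutral) (auto simp: le_less)
  finally show ?thesis .
qed

end

section \<open>Orthonormal polynomials and para-orthogonal polynomials\<close>

locale opuc = circle_measure +
  fixes \<phi> :: "nat \<Rightarrow> complex poly"
  assumes orthonormal: "orthonormal_polys M \<phi>"
begin

lemma degree_phi [simp]: "degree (\<phi> n) = n"
  using orthonormal by (simp add: orthonormal_polys_def)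

lemma ip_phi: "ip (\<phi> n) (\<phi> m) = (if m = n then 1 else 0)"
  using orthonormal by (simp add: orthonormal_polys_def ip_def)

lemma phi_nonzero [simp]: "\<phi> n \<noteq> 0"
proof
  assume "\<phi> n = 0"
  with ip_phi[of n n] show False by simp
qed

text \<open>By induction on \<open>j\<close>, subtracting a multiple of \<open>\<phi>\<^sub>j\<close> removes the leading term of a polynomial
  with at most \<open>j + 1\<close> coefficients without changing its inner product with \<open>\<phi>\<^sub>m\<close>, as \<open>j < m\<close>.\<close>

lemma ip_lower_phi:
  assumes "\<And>i. i \<ge> m \<Longrightarrow> coeff f i = 0"
  shows "ip f (\<phi> m) = 0"
proof -
  have "j \<le> m \<Longrightarrow> (\<And>i. i \<ge> j \<Longrightarrow> coeff f i = 0) \<Longrightarrow> ip f (\<phi> m) = 0" for j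
  proof (induction j arbitrary: f)
    case 0
    then have "f = 0" by (simp add: poly_eqI)
    then show ?case by simp
  next
    case (Suc j)
    have lc: "coeff (\<phi> j) j \<noteq> 0"
      using leading_coeff_neq_0[OF phi_nonzero[of j]] by simp
    define c where "c = coeff f j / coeff (\<phi> j) j"
    have "coeff (f - smult c (\<phi> j)) i = 0" if "i \<ge> j" for i
    proof (cases "i = j")
      case True
      then show ?thesis using lc by (simp add: c_def)
    next
      case False
      then show ?thesis using that Suc.prems by (simp add: coeff_eq_0)
    qed
    with Suc have "ip (f - smult c (\<phi> j)) (\<phi> m) = 0" by simp
    then show ?case
      using Suc.prems(1) by (simp add: ip_diff_left ip_smult_left ip_phi)
  qed
  from this[of m] assms show ?thesis by simp
qed

lemma ip_same_degree_phi:
  assumes "\<And>i. i > m \<Longrightarrow> coeff f i = 0"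
  shows "ip f (\<phi> m) = coeff f m / coeff (\<phi> m) m"
proof -
  have lc: "coeff (\<phi> m) m \<noteq> 0"
    using leading_coeff_neq_0[OF phi_nonzero[of m]] by simp
  define c where "c = coeff f m / coeff (\<phi> m) m"
  have "coeff (f - smult c (\<phi> m)) i = 0" if "i \<ge> m" for i
    using that lc assms by (cases "i = m") (auto simp: c_def coeff_eq_0)
  then have "ip (f - smult c (\<phi> m)) (\<phi> m) = 0"
    by (rule ip_lower_phi)
  then show ?thesis
    by (simp add: ip_diff_left ip_smult_left ip_phi c_def)
qed

text \<open>Definiteness is inherited from the orthonormal family: a polynomial that vanishes almost
  everywhere is orthogonal to the \<open>\<phi>\<^sub>k\<close> of its own degree \<open>k\<close>, and that inner product is a nonzero
  multiple of its leading coefficient.\<close>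

lemma norm2_eq_0_imp:
  assumes "norm2 f = 0"
  shows "f = 0"
proof -
  have "AE z in M. (norm (poly f z))\<^sup>2 = 0"
    using assms integral_nonneg_eq_0_iff_AE[OF integrable_norm2[of f]] by (simp add: norm2_def)
  then have "AE z in M. poly f z * cnj (poly (\<phi> (degree f)) z) = 0"
    by eventually_elim simp
  then have "ip f (\<phi> (degree f)) = 0"
    unfolding ip_def by (rule integral_eq_zero_AE)
  then have "coeff f (degree f) = 0"
    using ip_same_degree_phi[of "degree f" f] leading_coeff_neq_0[OF phi_nonzero[of "degree f"]]
    by (simp add: coeff_eq_0)
  then show ?thesis by simp
qed

lemma eq_0_if_orth_monoms:
  assumes "degree f \<le> m" and "\<And>j. j \<le> m \<Longrightarrow> ip f (monom 1 j) = 0"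
  shows "f = 0"
proof -
  have "ip f f = 0"
    by (rule ip_eq_0_if_orth_monoms[of "Suc m"]) (use assms in \<open>auto intro: coeff_eq_0\<close>)
  then show ?thesis
    by (intro norm2_eq_0_imp) (simp add: ip_self)
qed

definition phi_star :: "nat \<Rightarrow> complex poly" where
  "phi_star m = reversed_poly (\<phi> m)"

lemma poly_phi_star: "z \<noteq> 0 \<Longrightarrow> poly (phi_star m) z = z ^ m * cnj (poly (\<phi> m) (1 / cnj z))"
  by (simp add: phi_star_def poly_reversed_poly)

lemma inverse_cnj_circle: "norm z = 1 \<Longrightarrow> 1 / cnj z = z"
  using complex_norm_square[of z] by (cases "z = 0") (auto simp: field_simps)

lemma poly_phi_star_circle: "norm z = 1 \<Longrightarrow> poly (phi_star m) z = z ^ m * cnj (poly (\<phi> m) z)"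
  using poly_phi_star[of z m] inverse_cnj_circle[of z] by fastforce

lemma norm_phi_star_circle: "norm z = 1 \<Longrightarrow> norm (poly (phi_star m) z) = norm (poly (\<phi> m) z)"
  by (simp add: poly_phi_star_circle norm_mult norm_power)

lemma degree_phi_star_le: "degree (phi_star m) \<le> m"
proof -
  have "degree (map_poly cnj (\<phi> m)) = m"
    by (subst degree_map_poly) auto
  with degree_reflect_poly_le[of "map_poly cnj (\<phi> m)"] show ?thesis
    by (simp add: phi_star_def reversed_poly_def)
qed

lemma phi_star_nonzero: "phi_star m \<noteq> 0"
  by (simp add: phi_star_def reversed_poly_def map_poly_eq_0_iff)

text \<open>On the circle, \<open>\<phi>\<^sub>m\<^sup>* cnj(z\<^sup>j) = z\<^sup>m\<^sup>-\<^sup>j cnj(\<phi>\<^sub>m)\<close>, so that orthogonality of \<open>\<phi>\<^sub>m\<close> to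
  \<open>1, \<dots>, z\<^sup>m\<^sup>-\<^sup>1\<close> turns into orthogonality of \<open>\<phi>\<^sub>m\<^sup>*\<close> to \<open>z, \<dots>, z\<^sup>m\<close>.\<close>

lemma phi_star_orth:
  assumes "1 \<le> j" "j \<le> m"
  shows "ip (phi_star m) (monom 1 j) = 0"
proof -
  have "poly (phi_star m) z * cnj (poly (monom 1 j) z)
      = 1 * (poly (monom 1 (m - j)) z * cnj (poly (\<phi> m) z))" if "norm z = 1" for z
  proof -
    have "z * cnj z = 1"
      using that by (simp add: complex_norm_square[symmetric])
    then have "z ^ j * cnj z ^ j = 1"
      by (metis power_mult_distrib power_one)
    moreover have "z ^ m = z ^ (m - j) * z ^ j"
      using assms by (simp flip: power_add)
    ultimately show ?thesis
      using that by (simp add: poly_phi_star_circle poly_monom algebra_simps)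
  qed
  from ip_cong[OF this] have "ip (phi_star m) (monom 1 j) = ip (monom 1 (m - j)) (\<phi> m)"
    by simp
  also have "\<dots> = 0"
    by (rule ip_lower_phi) (use assms in \<open>auto simp: coeff_monom\<close>)
  finally show ?thesis .
qed

lemma shifted_phi_orth:
  assumes "1 \<le> j" "j \<le> m"
  shows "ip (pCons 0 (\<phi> m)) (monom 1 j) = 0"
proof -
  obtain i where i: "j = Suc i" "i < m"
    using assms by (cases j) auto
  have "ip (monom 1 i) (\<phi> m) = 0"
    by (rule ip_lower_phi) (use i in \<open>auto simp: coeff_monom\<close>)
  then have "ip (\<phi> m) (monom 1 i) = 0"
    using ip_commute[of "\<phi> m" "monom 1 i"] by simp
  then show ?thesis
    using i by (simp add: monom_Suc ip_pCons_pCons)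
qed

text \<open>The polynomials of degree at most \<open>m\<close> orthogonal to \<open>z, \<dots>, z\<^sup>m\<close> form a line: one inner product
  with the constant \<open>1\<close> determines such a polynomial, and \<open>\<phi>\<^sub>m\<^sup>*\<close> lies on the line.\<close>

lemma multiple_of_phi_star:
  assumes "degree f \<le> m" and "\<And>j. 1 \<le> j \<Longrightarrow> j \<le> m \<Longrightarrow> ip f (monom 1 j) = 0"
  shows "\<exists>\<beta>. f = smult \<beta> (phi_star m)"
proof -
  have all_orth: "ip g (monom 1 j) = 0"
    if "ip g (monom 1 0) = 0" "\<And>j. 1 \<le> j \<Longrightarrow> j \<le> m \<Longrightarrow> ip g (monom 1 j) = 0" "j \<le> m" for g j
    using that by (cases "j = 0") auto
  have ne: "ip (phi_star m) (monom 1 0) \<noteq> 0"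
    using eq_0_if_orth_monoms[OF degree_phi_star_le all_orth] phi_star_orth phi_star_nonzero by blast
  define \<beta> where "\<beta> = ip f (monom 1 0) / ip (phi_star m) (monom 1 0)"
  have "f - smult \<beta> (phi_star m) = 0"
  proof (rule eq_0_if_orth_monoms)
    show "degree (f - smult \<beta> (phi_star m)) \<le> m"
      by (intro degree_diff_le assms order.trans[OF degree_smult_le] degree_phi_star_le)
    show "ip (f - smult \<beta> (phi_star m)) (monom 1 j) = 0" if "j \<le> m" for j
    proof (rule all_orth)
      show "ip (f - smult \<beta> (phi_star m)) (monom 1 0) = 0"
        using ne unfolding ip_diff_left ip_smult_left \<beta>_def by simp
    qed (use assms phi_star_orth that in \<open>auto simp: ip_diff_left ip_smult_left\<close>)
  qed
  then show ?thesis by auto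
qed

text \<open>The Szego recurrence: after cancellation of the leading term of \<open>\<phi>\<^sub>m\<^sub>+\<^sub>1\<close> against that of \<open>z \<phi>\<^sub>m\<close>, the
  remainder is still orthogonal to \<open>z, \<dots>, z\<^sup>m\<close>.\<close>

lemma recurrence:
  "\<exists>\<alpha> \<beta>. \<phi> (Suc m) = smult \<alpha> (pCons 0 (\<phi> m)) + smult \<beta> (phi_star m)"
proof -
  have lc: "coeff (\<phi> m) m \<noteq> 0"
    using leading_coeff_neq_0[OF phi_nonzero[of m]] by simp
  define \<alpha> where "\<alpha> = coeff (\<phi> (Suc m)) (Suc m) / coeff (\<phi> m) m"
  let ?f = "\<phi> (Suc m) - smult \<alpha> (pCons 0 (\<phi> m))"
  have "\<exists>\<beta>. ?f = smult \<beta> (phi_star m)"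
  proof (rule multiple_of_phi_star)
    show "degree ?f \<le> m"
    proof (rule degree_le, safe)
      fix i assume "m < i"
      then show "coeff ?f i = 0"
        using lc by (cases "i = Suc m") (auto simp: \<alpha>_def coeff_eq_0 coeff_pCons split: nat.splits)
    qed
    fix j assume j: "1 \<le> j" "j \<le> m"
    have "ip (monom 1 j) (\<phi> (Suc m)) = 0"
      by (rule ip_lower_phi) (use j in \<open>auto simp: coeff_monom\<close>)
    then have "ip (\<phi> (Suc m)) (monom 1 j) = 0"
      using ip_commute[of "\<phi> (Suc m)" "monom 1 j"] by simp
    with shifted_phi_orth[OF j] show "ip ?f (monom 1 j) = 0"
      by (simp only: ip_diff_left ip_smult_left) simp
  qed
  then obtain \<beta> where "?f = smult \<beta> (phi_star m)" by blast
  then have "\<phi> (Suc m) = smult \<alpha> (pCons 0 (\<phi> m)) + smult \<beta> (phi_star m)"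
    by (simp add: algebra_simps)
  then show ?thesis by blast
qed

text \<open>Indexed by the degree \<open>m\<close> of \<open>\<phi>\<^sub>m\<close>, one less than the degree of the polynomial itself; this
  avoids the truncated subtraction in \<^const>\<open>para_orth_poly\<close>.\<close>

definition para :: "nat \<Rightarrow> complex \<Rightarrow> complex poly" where
  "para m u = pCons 0 (\<phi> m) + smult u (phi_star m)"

lemma para_orth_poly_Suc: "para_orth_poly \<phi> (Suc m) u = para m u"
  by (simp add: para_orth_poly_def para_def phi_star_def)

lemma coeff_para_top: "coeff (para m u) (Suc m) = coeff (\<phi> m) m"
  using coeff_eq_0[of "phi_star m" "Suc m"] degree_phi_star_le[of m] by (simp add: para_def)

lemma degree_para: "degree (para m u) = Suc m"
proof (rule antisym)
  show "degree (para m u) \<le> Suc m"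
    unfolding para_def using degree_phi_star_le[of m]
    by (intro degree_add_le) (auto intro: order.trans[OF degree_smult_le])
  show "Suc m \<le> degree (para m u)"
    by (intro le_degree) (simp add: coeff_para_top leading_coeff_neq_0[of "\<phi> m", simplified])
qed

lemma para_nonzero: "para m u \<noteq> 0"
  using degree_para[of m u] by auto

lemma para_orth:
  assumes "\<And>i. i \<ge> m \<Longrightarrow> coeff g i = 0"
  shows "ip (para m u) (pCons 0 g) = 0"
proof -
  have "ip (pCons 0 (\<phi> m)) (pCons 0 g) = 0"
    using ip_lower_phi[OF assms] ip_commute[of "\<phi> m" g] by (simp add: ip_pCons_pCons)
  moreover have "ip (phi_star m) (pCons 0 g) = 0"
  proof -
    have g: "degree (pCons 0 g) \<le> m"
      by (intro degree_le) (use assms in \<open>auto simp: coeff_pCons split: nat.splits\<close>)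
    then have "ip (phi_star m) (pCons 0 g)
        = (\<Sum>i\<le>m. cnj (coeff (pCons 0 g) i) * ip (phi_star m) (monom 1 i))"
      by (subst poly_as_sum_of_monoms'[symmetric, OF g])
        (simp flip: ip_smult_right add: smult_monom ip_sum_right del: coeff_pCons_0)
    also have "\<dots> = 0"
    proof (intro sum.neutral ballI)
      fix i assume "i \<in> {..m}"
      then show "cnj (coeff (pCons 0 g) i) * ip (phi_star m) (monom 1 i) = 0"
        using phi_star_orth[of i m] by (cases "i = 0") auto
    qed
    finally show ?thesis .
  qed
  ultimately show ?thesis
    by (simp add: para_def ip_add_left ip_smult_left)
qed

section \<open>Quotients of para-orthogonal polynomials as reproducing kernels\<close>

lemma para_quotient_degree:
  assumes "para m u = [:- y, 1:] * q"
  shows "degree q = m" and "coeff q m = coeff (\<phi> m) m"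
proof -
  have q0: "q \<noteq> 0"
    using assms para_nonzero[of m u] by auto
  then have "degree (para m u) = Suc (degree q)"
    unfolding assms by (subst degree_mult_eq) auto
  then show d: "degree q = m"
    by (simp add: degree_para)
  have "lead_coeff (para m u) = lead_coeff q"
    unfolding assms by (simp only: lead_coeff_mult) simp
  then show "coeff q m = coeff (\<phi> m) m"
    using d by (simp add: degree_para coeff_para_top)
qed

text \<open>On the circle \<open>z - y = - y z cnj(z - y)\<close> when \<open>\<bar>y\<bar> = 1\<close>. Hence, in an inner product with \<open>q\<close>, a factor
  \<open>z - y\<close> of the left argument moves to the right, where it completes \<open>q\<close> to the para-orthogonal
  polynomial: \<open>\<langle>(z - y) g, q\<rangle> = - y \<langle>z g, (z - y) q\<rangle> = 0\<close>. So \<open>\<langle>f, q\<rangle>\<close> depends on \<open>f(y)\<close> only.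
  The constant of proportionality comes from \<open>f = \<phi>\<^sub>m\<close>, for which the inner product is \<open>1\<close> because
  \<open>q\<close> has the degree and the leading coefficient of \<open>\<phi>\<^sub>m\<close>. In particular \<open>\<phi>\<^sub>m(y) \<noteq> 0\<close>.\<close>

lemma para_quotient_reproducing:
  assumes y: "norm y = 1" and q: "para m u = [:- y, 1:] * q"
  shows "poly (\<phi> m) y \<noteq> 0"
    and "degree f \<le> m \<Longrightarrow> ip f q = poly f y / poly (\<phi> m) y"
proof -
  have evaluation: "ip f q = poly f y * ip 1 q" if "degree f \<le> m" for f
  proof -
    define g where "g = synthetic_div f y"
    have f: "f = [:- y, 1:] * g + [:poly f y:]"
      using synthetic_div_correct'[of y f] by (simp add: g_def)
    have g0: "coeff g i = 0" if "i \<ge> m" for i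
    proof (cases "g = 0")
      case False
      then have "degree g < m"
        using \<open>degree f \<le> m\<close> by (simp add: g_def degree_synthetic_div synthetic_div_eq_0_iff)
      then show ?thesis using that by (intro coeff_eq_0) simp
    qed simp
    have "poly ([:- y, 1:] * g) z * cnj (poly q z)
        = (- y) * (poly (pCons 0 g) z * cnj (poly (para m u) z))" if "norm z = 1" for z
    proof -
      have "z * cnj z = 1" "y * cnj y = 1"
        using that y by (simp_all add: complex_norm_square[symmetric])
      then have "z - y = - y * (z * (cnj z - cnj y))"
        by (simp add: algebra_simps)
      then have "(z - y) * (poly g z * cnj (poly q z))
          = - y * (z * (cnj z - cnj y)) * (poly g z * cnj (poly q z))"
        by (simp only:)
      then show ?thesis
        by (simp add: q algebra_simps)
    qed
    from ip_cong[OF this] have "ip ([:- y, 1:] * g) q = - y * ip (pCons 0 g) (para m u)" .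
    also have "ip (pCons 0 g) (para m u) = 0"
      using para_orth[OF g0, where u = u] ip_commute[of "pCons 0 g" "para m u"] by simp
    finally have "ip ([:- y, 1:] * g) q = 0" by simp
    moreover have "[:poly f y:] = smult (poly f y) 1" by simp
    ultimately show ?thesis
      by (subst f) (simp only: ip_add_left ip_smult_left add_0)
  qed
  have "ip q (\<phi> m) = 1"
    using ip_same_degree_phi[of m q] para_quotient_degree[OF q] coeff_eq_0[of q]
      leading_coeff_neq_0[OF phi_nonzero[of m]] by simp
  then have "ip (\<phi> m) q = 1"
    using ip_commute[of "\<phi> m" q] by simp
  with evaluation[of "\<phi> m"] have *: "poly (\<phi> m) y * ip 1 q = 1" by simp
  then show "poly (\<phi> m) y \<noteq> 0" by auto
  with * have "ip 1 q = 1 / poly (\<phi> m) y"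
    by (simp add: field_simps)
  then show "ip f q = poly f y / poly (\<phi> m) y" if "degree f \<le> m"
    using evaluation[OF that] by simp
qed

text \<open>The numerator of the quotient is at most \<open>2 \<bar>\<phi>\<^sub>m\<bar>\<close> on the circle, where \<open>\<phi>\<^sub>m\<close> has norm \<open>1\<close>, and the
  denominator is at least \<open>d\<close> almost everywhere.\<close>

lemma para_quotient_norm2_le:
  assumes q: "para m u = [:- y, 1:] * q" and u: "norm u = 1"
    and d: "d > 0" and far: "AE z in M. d \<le> norm (z - y)"
  shows "norm2 q \<le> 4 / d\<^sup>2"
proof -
  have unit: "norm2 (\<phi> m) = 1"
    using ip_self[of "\<phi> m"] ip_phi[of m m] by (metis of_real_eq_1_iff)
  have "d\<^sup>2 * norm2 q = (LINT z|M. d\<^sup>2 * (norm (poly q z))\<^sup>2)"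
    unfolding norm2_def by simp
  also have "\<dots> \<le> (LINT z|M. 4 * (norm (poly (\<phi> m) z))\<^sup>2)"
  proof (rule integral_mono_AE)
    show "AE z in M. d\<^sup>2 * (norm (poly q z))\<^sup>2 \<le> 4 * (norm (poly (\<phi> m) z))\<^sup>2"
      using far AE_space
    proof eventually_elim
      case (elim z)
      then have z: "norm z = 1" by (simp add: space_M)
      have "d * norm (poly q z) \<le> norm (z - y) * norm (poly q z)"
        using elim by (intro mult_right_mono) auto
      also have "\<dots> = norm (poly (para m u) z)"
        by (simp add: q norm_mult flip: left_diff_distrib)
      also have "\<dots> \<le> norm (z * poly (\<phi> m) z) + norm (u * poly (phi_star m) z)"
        unfolding para_def by (simp add: norm_triangle_ineq)
      also have "\<dots> = 2 * norm (poly (\<phi> m) z)"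
        using z u norm_phi_star_circle[OF z] by (simp add: norm_mult)
      finally have "(d * norm (poly q z))\<^sup>2 \<le> (2 * norm (poly (\<phi> m) z))\<^sup>2"
        using d by (intro power_mono) auto
      then show ?case
        by (simp add: power_mult_distrib)
    qed
  qed (use integrable_norm2 in auto)
  also have "\<dots> = 4"
    using unit unfolding norm2_def by simp
  finally show ?thesis
    using d by (simp add: field_simps)
qed

section \<open>The phase function\<close>

text \<open>A quotient of modulus \<open>1\<close> on the circle whose level sets there are the zero sets of the
  para-orthogonal polynomials.\<close>

definition phase :: "nat \<Rightarrow> complex \<Rightarrow> complex" where
  "phase m z = z * poly (\<phi> m) z / poly (phi_star m) z"

text \<open>A zero of \<open>\<phi>\<^sub>m\<close> on the circle would be a zero of \<open>z \<phi>\<^sub>m\<close>, the case \<open>u = 0\<close> of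
  \<open>para_quotient_reproducing\<close>.\<close>

lemma phi_nonzero_circle:
  assumes "norm y = 1"
  shows "poly (\<phi> m) y \<noteq> 0" and "poly (phi_star m) y \<noteq> 0"
proof -
  show *: "poly (\<phi> m) y \<noteq> 0"
  proof
    assume 0: "poly (\<phi> m) y = 0"
    then have "poly (para m 0) y = 0"
      by (simp add: para_def)
    then obtain q where "para m 0 = [:- y, 1:] * q"
      by (meson poly_eq_0_iff_dvd dvd_def)
    from para_quotient_reproducing(1)[OF assms this] 0 show False by simp
  qed
  with norm_phi_star_circle[OF assms, of m] show "poly (phi_star m) y \<noteq> 0"
    by auto
qed

lemma norm_phase:
  assumes "norm y = 1"
  shows "norm (phase m y) = 1"
  using assms phi_nonzero_circle[OF assms, of m] norm_phi_star_circle[OF assms, of m]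
  by (simp add: phase_def norm_mult norm_divide)

lemma poly_para_eq_phase:
  assumes "norm y = 1"
  shows "poly (para m u) y = poly (phi_star m) y * (phase m y + u)"
  using phi_nonzero_circle[OF assms, of m] by (simp add: para_def phase_def field_simps)

lemma poly_para_eq_0_iff:
  assumes "norm y = 1"
  shows "poly (para m u) y = 0 \<longleftrightarrow> phase m y = - u"
  using phi_nonzero_circle[OF assms, of m]
  by (simp add: poly_para_eq_phase[OF assms] eq_neg_iff_add_eq_0)

text \<open>Every point \<open>t\<close> of the circle is a zero of some para-orthogonal polynomial, namely the one for
  \<open>u = - b\<^sub>m(t)\<close>. With the quotients \<open>p, q\<close> obtained in this way for \<open>x, y\<close>, the reproducing property of
  \<open>q\<close> evaluates \<open>\<langle>p, q\<rangle>\<close> to the difference quotient of the phase, up to a factor of modulus \<open>1\<close>.\<close>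

lemma phase_Lipschitz_off_support:
  assumes x: "norm x = 1" and y: "norm y = 1" and d: "d > 0"
    and far_x: "AE z in M. d \<le> norm (z - x)" and far_y: "AE z in M. d \<le> norm (z - y)"
  shows "norm (phase m x - phase m y) \<le> 4 / d\<^sup>2 * norm (x - y)"
proof -
  have quotient: "\<exists>q. para m (- phase m t) = [:- t, 1:] * q" if "norm t = 1" for t
  proof -
    have "poly (para m (- phase m t)) t = 0"
      using that by (simp add: poly_para_eq_0_iff)
    then show ?thesis by (meson poly_eq_0_iff_dvd dvd_def)
  qed
  obtain p q where p: "para m (- phase m x) = [:- x, 1:] * p"
    and q: "para m (- phase m y) = [:- y, 1:] * q"
    using quotient x y by blast
  have "ip p q = poly p y / poly (\<phi> m) y"
    using para_quotient_reproducing(2)[OF y q] para_quotient_degree[OF p] by simp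
  then have "norm (ip p q) * norm (poly (\<phi> m) y) = norm (poly p y)"
    using phi_nonzero_circle[OF y, of m] by (simp add: norm_divide)
  then have "norm (y - x) * norm (ip p q) * norm (poly (\<phi> m) y) = norm ((y - x) * poly p y)"
    by (simp add: norm_mult)
  also have "(y - x) * poly p y = poly (phi_star m) y * (phase m y - phase m x)"
    using poly_para_eq_phase[OF y, of m "- phase m x"] by (simp add: p algebra_simps)
  also have "norm \<dots> = norm (phase m y - phase m x) * norm (poly (\<phi> m) y)"
    by (simp add: norm_mult norm_phi_star_circle[OF y])
  finally have "norm (phase m x - phase m y) = norm (ip p q) * norm (x - y)"
    using phi_nonzero_circle[OF y, of m] by (simp add: norm_minus_commute mult.commute)
  also have "norm (ip p q) \<le> (norm2 p + norm2 q) / 2"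
    by (rule norm_ip_le)
  also have "\<dots> \<le> 4 / d\<^sup>2"
    using para_quotient_norm2_le[OF p _ d far_x] para_quotient_norm2_le[OF q _ d far_y]
      norm_phase x y by simp
  finally show ?thesis
    by (simp add: mult_right_mono)
qed

text \<open>Put \<open>b = b\<^sub>m(t)\<close>. By the recurrence \<open>\<phi>\<^sub>m\<^sub>+\<^sub>1 = \<phi>\<^sub>m\<^sup>* (\<alpha> b + \<beta>)\<close> at \<open>t\<close>, and reversal on the circle gives
  \<open>\<phi>\<^sub>m\<^sub>+\<^sub>1\<^sup>* = \<phi>\<^sub>m\<^sup>* b cnj(\<alpha> b + \<beta>)\<close> there. The factor \<open>\<phi>\<^sub>m\<^sup>*\<close> cancels, so \<open>b\<^sub>m\<^sub>+\<^sub>1(t) / t\<close> is a function of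
  \<open>b\<close> that does not involve \<open>t\<close>.\<close>

lemma phase_Suc_eq:
  assumes x: "norm x = 1" and y: "norm y = 1" and eq: "phase m x = phase m y"
  shows "phase (Suc m) x * y = phase (Suc m) y * x"
proof -
  obtain \<alpha> \<beta> where rec: "\<phi> (Suc m) = smult \<alpha> (pCons 0 (\<phi> m)) + smult \<beta> (phi_star m)"
    using recurrence by blast
  have "phase (Suc m) t = t * ((\<alpha> * phase m t + \<beta>) / (phase m t * cnj (\<alpha> * phase m t + \<beta>)))"
    if t: "norm t = 1" for t
  proof -
    let ?b = "phase m t" and ?s = "poly (phi_star m) t" and ?f = "poly (\<phi> m) t"
    have nz: "?s \<noteq> 0" "?f \<noteq> 0" "t \<noteq> 0"
      using phi_nonzero_circle[OF t, of m] t by auto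
    have "poly (\<phi> (Suc m)) t = ?s * (\<alpha> * ?b + \<beta>)"
      using nz by (simp add: rec phase_def field_simps)
    moreover have "t * cnj t = 1"
      using t by (simp add: complex_norm_square[symmetric])
    then have ct: "cnj t = 1 / t"
      using nz by (simp add: field_simps)
    have "cnj ?s = ?f / t ^ m"
      using nz by (simp add: poly_phi_star_circle[OF t] ct power_one_over field_simps)
    then have "t ^ Suc m * cnj ?s = ?s * ?b"
      using nz by (simp add: phase_def)
    moreover have "poly (phi_star (Suc m)) t = t ^ Suc m * cnj (poly (\<phi> (Suc m)) t)"
      using t by (rule poly_phi_star_circle)
    ultimately have "phase (Suc m) t
        = t * (?s * (\<alpha> * ?b + \<beta>)) / (?s * ?b * cnj (\<alpha> * ?b + \<beta>))"
      unfolding phase_def[of "Suc m"] by (metis (no_types, lifting) complex_cnj_mult mult.assoc)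
    then show ?thesis using nz by simp
  qed
  from this[OF x] this[OF y] eq show ?thesis by simp
qed

section \<open>Zeros of para-orthogonal polynomials\<close>

text \<open>For \<open>\<bar>u\<bar> = 1\<close> the para-orthogonal polynomial is a constant multiple of its own reversal.\<close>

lemma para_reflected_zero:
  assumes "norm u = 1" and zero: "poly (para m u) y = 0"
  shows "y \<noteq> 0" and "poly (para m u) (1 / cnj y) = 0"
proof -
  show y: "y \<noteq> 0"
  proof
    assume "y = 0"
    then have "poly (phi_star m) 0 = 0"
      using zero assms by (auto simp: para_def)
    then show False
      by (simp add: phi_star_def reversed_poly_def map_poly_eq_0_iff)
  qed
  have uu: "u * cnj u = 1"
    using assms by (simp add: complex_norm_square[symmetric])
  have "y * poly (\<phi> m) y + u * (y ^ m * cnj (poly (\<phi> m) (1 / cnj y))) = 0"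
    using zero y by (simp add: para_def poly_phi_star)
  then have "cnj (y * poly (\<phi> m) y + u * (y ^ m * cnj (poly (\<phi> m) (1 / cnj y)))) = 0"
    by simp
  then have "cnj y * cnj (poly (\<phi> m) y) = - cnj u * cnj y ^ m * poly (\<phi> m) (1 / cnj y)"
    by (simp add: eq_neg_iff_add_eq_0 mult.assoc)
  then have "u * (cnj y * cnj (poly (\<phi> m) y)) = - (u * cnj u) * cnj y ^ m * poly (\<phi> m) (1 / cnj y)"
    by simp
  then have "u * cnj (poly (\<phi> m) y) = - (cnj y ^ m * poly (\<phi> m) (1 / cnj y)) / cnj y"
    unfolding uu using y by (simp add: field_simps)
  moreover have "poly (phi_star m) (1 / cnj y) = cnj (poly (\<phi> m) y) / cnj y ^ m"
    using y by (simp add: poly_phi_star power_one_over)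
  then have "u * poly (phi_star m) (1 / cnj y) = u * cnj (poly (\<phi> m) y) / cnj y ^ m"
    by simp
  ultimately have "u * poly (phi_star m) (1 / cnj y) = - poly (\<phi> m) (1 / cnj y) / cnj y"
    using y by simp
  then show "poly (para m u) (1 / cnj y) = 0"
    by (simp add: para_def)
qed

text \<open>A zero \<open>y\<close> off the circle would come with a second zero \<open>1 / cnj y\<close>. Splitting off both factors
  leaves \<open>g\<close> of degree below \<open>m\<close>, and on the circle the product of the two factors is a constant times
  \<open>z \<bar>z - y\<bar>\<^sup>2\<close>. Orthogonality to \<open>z g\<close> then forces \<open>(z - y) g\<close> to have norm \<open>0\<close>.\<close>

lemma norm_para_zero:
  assumes u: "norm u = 1" and zero: "poly (para m u) y = 0"
  shows "norm y = 1"
proof (rule ccontr)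
  assume ny: "norm y \<noteq> 1"
  have y: "y \<noteq> 0" and y': "poly (para m u) (1 / cnj y) = 0"
    using para_reflected_zero[OF u zero] by auto
  have ne: "1 / cnj y \<noteq> y"
  proof
    assume "1 / cnj y = y"
    then have "y * cnj y = 1"
      using y by (simp add: field_simps)
    then have "(norm y)\<^sup>2 = 1"
      by (metis complex_norm_square of_real_eq_1_iff)
    with ny show False
      by (simp add: power2_eq_1_iff) (use norm_ge_zero[of y] in linarith)
  qed
  obtain h where h: "para m u = [:- y, 1:] * h"
    using zero by (meson poly_eq_0_iff_dvd dvd_def)
  then have "poly (para m u) (1 / cnj y) = (1 / cnj y - y) * poly h (1 / cnj y)"
    by (simp add: left_diff_distrib)
  with y' ne have "poly h (1 / cnj y) = 0"
    by simp
  then obtain g where g: "h = [:- (1 / cnj y), 1:] * g"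
    by (meson poly_eq_0_iff_dvd dvd_def)
  have g0: "g \<noteq> 0"
    using g h para_nonzero[of m u] by auto
  have "degree h = Suc (degree g)"
    unfolding g using g0 by (subst degree_mult_eq) auto
  then have "degree g < m"
    using para_quotient_degree(1)[OF h] by simp
  then have orth: "ip (para m u) (pCons 0 g) = 0"
    by (intro para_orth coeff_eq_0) simp
  have "poly (para m u) z * cnj (poly (pCons 0 g) z)
      = (- 1 / cnj y) * (poly ([:- y, 1:] * g) z * cnj (poly ([:- y, 1:] * g) z))"
    if "norm z = 1" for z
  proof -
    have "z * cnj z = 1"
      using that by (simp add: complex_norm_square[symmetric])
    then have "(z - 1 / cnj y) * cnj z = (- 1 / cnj y) * (cnj z - cnj y)"
      using y by (simp add: field_simps)
    then have "(z - y) * ((z - 1 / cnj y) * cnj z) * (poly g z * cnj (poly g z))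
       = (z - y) * ((- 1 / cnj y) * (cnj z - cnj y)) * (poly g z * cnj (poly g z))"
      by (simp only:)
    moreover have "poly (para m u) z * cnj (poly (pCons 0 g) z)
       = (z - y) * ((z - 1 / cnj y) * cnj z) * (poly g z * cnj (poly g z))"
      by (simp add: h g) (simp add: algebra_simps diff_divide_distrib)
    moreover have "(- 1 / cnj y) * (poly ([:- y, 1:] * g) z * cnj (poly ([:- y, 1:] * g) z))
       = (z - y) * ((- 1 / cnj y) * (cnj z - cnj y)) * (poly g z * cnj (poly g z))"
      by (simp add: algebra_simps diff_divide_distrib)
    ultimately show ?thesis by (simp only:)
  qed
  from ip_cong[OF this] orth y have "norm2 ([:- y, 1:] * g) = 0"
    by (simp only: ip_self) simp
  then have "[:- y, 1:] * g = 0"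
    by (rule norm2_eq_0_imp)
  then show False
    using g0 by (simp only: mult_eq_0_iff) simp
qed

text \<open>The zeros on the circle are simple, since \<open>\<parallel>q\<parallel>\<^sup>2 = q(y) / \<phi>\<^sub>m(y)\<close> is not \<open>0\<close>.\<close>

lemma para_quotient_nonzero:
  assumes y: "norm y = 1" and q: "para m u = [:- y, 1:] * q"
  shows "poly q y \<noteq> 0"
proof
  assume "poly q y = 0"
  then have "ip q q = 0"
    using para_quotient_reproducing(2)[OF y q, of q] para_quotient_degree(1)[OF q] by simp
  then have "q = 0"
    by (intro norm2_eq_0_imp) (simp add: ip_self)
  then show False
    using q para_nonzero[of m u] by simp
qed

lemma card_para_zeros:
  assumes u: "norm u = 1"
  shows "card {z. poly (para m u) z = 0} = Suc m"
proof -
  let ?P = "para m u"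
  have "rsquarefree ?P"
    unfolding rsquarefree_def
  proof (intro conjI allI para_nonzero)
    fix y
    show "order y ?P = 0 \<or> order y ?P = 1"
    proof (cases "poly ?P y = 0")
      case True
      then obtain q where q: "?P = [:- y, 1:] * q"
        by (meson poly_eq_0_iff_dvd dvd_def)
      with para_quotient_nonzero[OF norm_para_zero[OF u True] q] have "order y q = 0"
        by (simp add: order_0I)
      moreover have "order y ?P = order y [:- y, 1:] + order y q"
        unfolding q by (rule order_mult) (use q para_nonzero[of m u] in auto)
      moreover have "order y [:- y, 1:] = 1"
        using order_power_n_n[of y 1] by simp
      ultimately show ?thesis by simp
    qed (simp add: order_0I)
  qed
  then have "?P = smult (lead_coeff ?P) (\<Prod>z | poly ?P z = 0. [:- z, 1:])"
    by (rule complex_poly_decompose_rsquarefree[symmetric])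
  then have "degree ?P = degree (\<Prod>z | poly ?P z = 0. [:- z, 1:])"
    by (metis degree_smult_eq leading_coeff_0_iff para_nonzero)
  also have "\<dots> = card {z. poly ?P z = 0}"
    by (subst degree_prod_eq_sum_degree) auto
  finally show ?thesis
    by (simp add: degree_para)
qed

text \<open>A consequence of Szego's quadrature formula. The quotients at
  different zeros are orthogonal, because each vanishes at all the other zeros, and Lagrange
  interpolation at the \<open>m + 1\<close> zeros expands every \<open>f\<close> of degree at most \<open>m\<close> in them. So
  \<open>\<parallel>f\<parallel>\<^sup>2 = \<Sum> \<bar>f(z)\<bar>\<^sup>2 s(z)\<close>, summed over the zeros, with weights \<open>s(z) \<ge> 0\<close> of total mass \<open>\<parallel>1\<parallel>\<^sup>2 = 1\<close>.\<close>

lemma norm2_le_on_para_zeros: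
  assumes u: "norm u = 1" and g: "degree g \<le> m"
    and bound: "\<And>z. poly (para m u) z = 0 \<Longrightarrow> (norm (poly g z))\<^sup>2 \<le> r"
  shows "norm2 g \<le> r"
proof -
  define Z where "Z = {z. poly (para m u) z = 0}"
  have fin: "finite Z"
    unfolding Z_def by (rule poly_roots_finite[OF para_nonzero])
  have "\<forall>z\<in>Z. \<exists>q. para m u = [:- z, 1:] * q"
    unfolding Z_def by (metis (mono_tags) mem_Collect_eq poly_eq_0_iff_dvd dvd_def)
  then obtain q where q: "\<And>z. z \<in> Z \<Longrightarrow> para m u = [:- z, 1:] * q z"
    by metis
  have circle: "norm z = 1" if "z \<in> Z" for z
    using that norm_para_zero[OF u] by (simp add: Z_def)
  have qz: "poly (q z) z \<noteq> 0" if "z \<in> Z" for z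
    using para_quotient_nonzero[OF circle q] that by blast
  have qw: "poly (q z) w = 0" if "z \<in> Z" "w \<in> Z" "w \<noteq> z" for z w
  proof -
    have "poly (para m u) w = 0"
      using that by (simp add: Z_def)
    then show ?thesis
      using q[OF that(1)] that(3) by simp
  qed
  have orth: "ip (q z) (q w) = 0" if "z \<in> Z" "w \<in> Z" "w \<noteq> z" for z w
    using para_quotient_reproducing(2)[OF circle q, of w "q z"] qw[OF that] that
      para_quotient_degree(1)[OF q[OF that(1)]] by simp
  define s where "s z = norm2 (q z) / (norm (poly (q z) z))\<^sup>2" for z
  have parseval: "norm2 f = (\<Sum>z\<in>Z. (norm (poly f z))\<^sup>2 * s z)" if "degree f \<le> m" for f
  proof -
    define c where "c z = poly f z / poly (q z) z" for z
    have "f = (\<Sum>z\<in>Z. smult (c z) (q z))"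
    proof (rule poly_eqI_degree[of Z])
      fix w assume w: "w \<in> Z"
      have "poly (\<Sum>z\<in>Z. smult (c z) (q z)) w = (\<Sum>z\<in>Z. if z = w then c w * poly (q w) w else 0)"
        unfolding poly_sum by (rule sum.cong) (use qw w in auto)
      also have "\<dots> = poly f w"
        using w fin qz[OF w] by (simp add: c_def)
      finally show "poly f w = poly (\<Sum>z\<in>Z. smult (c z) (q z)) w" by simp
    next
      have cz: "card Z = Suc m"
        unfolding Z_def by (rule card_para_zeros[OF u])
      show "degree f < card Z"
        using that cz by simp
      have "degree (\<Sum>z\<in>Z. smult (c z) (q z)) \<le> m"
        using fin para_quotient_degree(1)[OF q]
        by (intro degree_sum_le) (auto intro: order.trans[OF degree_smult_le])
      then show "degree (\<Sum>z\<in>Z. smult (c z) (q z)) < card Z"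
        using cz by simp
    qed
    then have "ip f f = (\<Sum>z\<in>Z. \<Sum>w\<in>Z. c z * (cnj (c w) * ip (q z) (q w)))"
      by (simp only: ip_sum_left ip_smult_left)
         (simp only: ip_sum_right ip_smult_right sum_distrib_left)
    also have "\<dots> = (\<Sum>z\<in>Z. \<Sum>w\<in>Z. if w = z then c z * (cnj (c z) * ip (q z) (q z)) else 0)"
      by (intro sum.cong refl) (use orth in auto)
    also have "\<dots> = (\<Sum>z\<in>Z. of_real ((norm (c z))\<^sup>2 * norm2 (q z)))"
      using fin by (intro sum.cong refl) (simp add: ip_self complex_norm_square mult.assoc del: of_real_power)
    finally have "norm2 f = (\<Sum>z\<in>Z. (norm (c z))\<^sup>2 * norm2 (q z))"
      unfolding ip_self by (metis of_real_eq_iff of_real_sum)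
    then show ?thesis
      by (simp add: c_def s_def norm_divide power_divide)
  qed
  have "norm2 g = (\<Sum>z\<in>Z. (norm (poly g z))\<^sup>2 * s z)"
    by (rule parseval[OF g])
  also have "\<dots> \<le> (\<Sum>z\<in>Z. r * s z)"
    using bound by (intro sum_mono mult_right_mono) (auto simp: s_def Z_def norm2_nonneg)
  also have "\<dots> = r * norm2 1"
    using parseval[of 1] by (simp add: sum_distrib_left)
  also have "norm2 1 = 1"
    by (simp add: norm2_def prob_space)
  finally show ?thesis by simp
qed

section \<open>Support points are strong limit points\<close>

text \<open>The power of \<open>(1 + z cnj w) / 2\<close>, a polynomial whose modulus on the circle is \<open>1\<close> at \<open>w\<close> and decreases
  with the distance from \<open>w\<close>.\<close>

abbreviation peak :: "complex \<Rightarrow> nat \<Rightarrow> complex poly" where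
  "peak w N \<equiv> [:1 / 2, cnj w / 2:] ^ N"

lemma norm_peak:
  assumes "norm w = 1" and "norm z = 1"
  shows "(norm (poly (peak w N) z))\<^sup>2 = (1 - (dist w z)\<^sup>2 / 4) ^ N"
proof -
  have "w * cnj w = 1" "z * cnj z = 1"
    using assms by (simp_all add: complex_norm_square[symmetric])
  moreover have "complex_of_real ((norm (1 / 2 + z * cnj w / 2))\<^sup>2)
      = (1 + z * cnj z * (w * cnj w) + (z * cnj w + w * cnj z)) / 4"
    unfolding complex_norm_square by (simp add: algebra_simps)
  moreover have "complex_of_real (1 - (dist w z)\<^sup>2 / 4)
      = 1 - (w * cnj w + z * cnj z - (z * cnj w + w * cnj z)) / 4"
    unfolding dist_norm of_real_diff of_real_divide complex_norm_square
    by (simp add: algebra_simps)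
  ultimately have "complex_of_real ((norm (1 / 2 + z * cnj w / 2))\<^sup>2)
      = complex_of_real (1 - (dist w z)\<^sup>2 / 4)"
    by (simp add: field_simps)
  then have "(norm (1 / 2 + z * cnj w / 2))\<^sup>2 = 1 - (dist w z)\<^sup>2 / 4"
    by (simp only: of_real_eq_iff)
  then show ?thesis
    by (simp add: poly_power norm_power) (metis mult.commute power_mult)
qed

lemma peak_base_nonneg:
  fixes w z :: complex
  assumes "norm w = 1" and "norm z = 1"
  shows "0 \<le> 1 - (dist w z)\<^sup>2 / 4"
  using norm_peak[OF assms, of 1] by (metis power_one_right zero_le_power2)

lemma norm2_peak_ge:
  assumes w: "norm w = 1" and \<delta>: "0 \<le> \<delta>" "\<delta> \<le> 1"
  shows "(1 - \<delta>\<^sup>2 / 4) ^ N * measure M (ball w \<delta> \<inter> space M) \<le> norm2 (peak w N)"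
proof -
  let ?B = "ball w \<delta> \<inter> space M"
  have meas: "?B \<in> sets M"
    unfolding sets_M space_M by (auto simp: sets_restrict_space)
  have "(1 - \<delta>\<^sup>2 / 4) ^ N * measure M ?B = (LINT z|M. (1 - \<delta>\<^sup>2 / 4) ^ N * indicat_real ?B z)"
    using meas by simp
  also have "\<dots> \<le> norm2 (peak w N)"
    unfolding norm2_def
  proof (rule integral_mono)
    show "integrable M (\<lambda>z. (1 - \<delta>\<^sup>2 / 4) ^ N * indicat_real ?B z)"
      using meas by (intro integrable_mult_right integrable_real_indicator) (auto simp: emeasure_eq_measure)
    fix z assume "z \<in> space M"
    then have z: "norm z = 1" by (simp add: space_M)
    show "(1 - \<delta>\<^sup>2 / 4) ^ N * indicat_real ?B z \<le> (norm (poly (peak w N) z))\<^sup>2"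
    proof (cases "z \<in> ?B")
      case True
      then have "(dist w z)\<^sup>2 \<le> \<delta>\<^sup>2"
        by (intro power_mono) auto
      moreover have "\<delta>\<^sup>2 \<le> 1"
        using \<delta> by (simp add: power_le_one)
      ultimately show ?thesis
        unfolding norm_peak[OF w z] using True by (simp add: power_mono)
    qed simp
  qed (rule integrable_norm2)
  finally show ?thesis .
qed

text \<open>If all zeros were outside the \<open>\<epsilon>\<close>-ball at \<open>w\<close>, then the mean square of the peak polynomial would be at most
  \<open>r\<^sup>N\<close>, whereas the mass of the \<open>\<epsilon>/2\<close>-ball alone contributes a fixed multiple of \<open>R\<^sup>N\<close> with \<open>R > r\<close>.
  The exponent \<open>N\<close> that decides in favour of the latter depends on \<open>\<epsilon>\<close> only, so the contradiction
  arises at every level \<open>m \<ge> N\<close>.\<close>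

lemma support_subset_strong_limit:
  assumes w: "w \<in> measure_supp M" and u: "\<forall>n\<ge>1. norm (u n) = 1"
  shows "w \<in> strong_limit_points (para_orth_zeros \<phi> u)"
  unfolding strong_limit_points_def mem_Collect_eq
proof (rule LIMSEQ_I)
  fix e0 :: real assume "e0 > 0"
  \<comment> \<open>The bound by \<open>1\<close> keeps the bases \<open>r\<close> and \<open>R\<close> of the powers below nonnegative.\<close>
  define \<epsilon> where "\<epsilon> = min e0 1"
  have \<epsilon>: "0 < \<epsilon>" "\<epsilon> \<le> 1" "\<epsilon> \<le> e0"
    using \<open>e0 > 0\<close> by (auto simp: \<epsilon>_def)
  have nw: "norm w = 1"
    using w by (simp add: measure_supp_def space_M)
  define \<mu> where "\<mu> = measure M (ball w (\<epsilon> / 2) \<inter> space M)"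
  have "emeasure M (ball w (\<epsilon> / 2) \<inter> space M) > 0"
    using w \<epsilon> by (simp add: measure_supp_def)
  then have \<mu>: "\<mu> > 0"
    by (simp add: \<mu>_def emeasure_eq_measure)
  define r where "r = 1 - \<epsilon>\<^sup>2 / 4"
  define R where "R = 1 - (\<epsilon> / 2)\<^sup>2 / 4"
  have "\<epsilon>\<^sup>2 \<le> 1"
    using \<epsilon> by (simp add: power_le_one)
  then have rR: "0 \<le> r" "r < R" "0 < R"
    using \<epsilon> by (auto simp: r_def R_def power2_eq_square)
  then have "(\<lambda>N. (r / R) ^ N) \<longlonglongrightarrow> 0"
    by (intro LIMSEQ_power_zero) auto
  then obtain N where "norm ((r / R) ^ N) < \<mu>"
    using LIMSEQ_D[OF _ \<mu>] by fastforce
  then have N: "r ^ N < R ^ N * \<mu>"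
    using rR by (simp add: power_divide field_simps)
  show "\<exists>no. \<forall>n\<ge>no. norm (infdist w (para_orth_zeros \<phi> u n) - 0) < e0"
  proof (intro exI allI impI)
    fix n assume "n \<ge> Suc N"
    then obtain m where m: "n = Suc m" "N \<le> m"
      by (cases n) auto
    have un: "norm (u n) = 1"
      using u m by simp
    have "\<exists>z\<in>para_orth_zeros \<phi> u n. dist w z < \<epsilon>"
    proof (rule ccontr)
      assume "\<not> ?thesis"
      then have far: "\<epsilon> \<le> dist w z" if "poly (para m (u n)) z = 0" for z
        using that m by (force simp: para_orth_zeros_def para_orth_poly_Suc)
      have "norm2 (peak w N) \<le> r ^ N"
      proof (rule norm2_le_on_para_zeros[OF un])
        show "degree (peak w N) \<le> m"
          using m(2) degree_power_le[of "[:1 / 2, cnj w / 2:]" N] nw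
          by (auto split: if_splits)
        fix z assume z0: "poly (para m (u n)) z = 0"
        have z: "norm z = 1"
          by (rule norm_para_zero[OF un z0])
        have "\<epsilon>\<^sup>2 \<le> (dist w z)\<^sup>2"
          using far[OF z0] \<epsilon> by (intro power_mono) auto
        then show "(norm (poly (peak w N) z))\<^sup>2 \<le> r ^ N"
          unfolding norm_peak[OF nw z] r_def
          by (intro power_mono peak_base_nonneg nw z) simp
      qed
      moreover have "R ^ N * \<mu> \<le> norm2 (peak w N)"
        unfolding R_def \<mu>_def by (rule norm2_peak_ge[OF nw]) (use \<epsilon> in auto)
      ultimately show False
        using N by linarith
    qed
    then obtain z where "z \<in> para_orth_zeros \<phi> u n" "dist w z < \<epsilon>" by blast
    then have "infdist w (para_orth_zeros \<phi> u n) < e0"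
      using infdist_le[of z "para_orth_zeros \<phi> u n" w] \<epsilon> by linarith
    then show "norm (infdist w (para_orth_zeros \<phi> u n) - 0) < e0"
      by (simp add: infdist_nonneg)
  qed
qed

section \<open>Limit points outside the support\<close>

text \<open>One radius serves a whole neighbourhood of \<open>w\<close>: half the radius of a null ball at \<open>w\<close>.\<close>

lemma off_support_gap:
  assumes "norm w = 1" and "w \<notin> measure_supp M"
  shows "\<exists>d>0. \<forall>x. dist x w < d \<longrightarrow> (AE z in M. d \<le> norm (z - x))"
proof -
  obtain U where U: "open U" "w \<in> U" and "\<not> emeasure M (U \<inter> space M) > 0"
    using assms by (auto simp: measure_supp_def space_M)
  then have null: "emeasure M (U \<inter> space M) = 0"
    by (simp add: zero_less_iff_neq_zero)
  have meas: "U \<inter> space M \<in> sets M"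
    unfolding sets_M space_M using U by (auto simp: sets_restrict_space)
  then have outside: "AE z in M. z \<notin> U \<inter> space M"
    using null by (intro AE_not_in) (simp add: null_sets_def)
  obtain e where e: "e > 0" "ball w e \<subseteq> U"
    using U by (meson open_contains_ball)
  have "AE z in M. e / 2 \<le> norm (z - x)" if "dist x w < e / 2" for x
    using outside AE_space
  proof eventually_elim
    case (elim z)
    then have "\<not> dist w z < e"
      using e by auto
    then show ?case
      using that dist_triangle[of w z x] by (simp add: dist_norm norm_minus_commute)
  qed
  then show ?thesis
    using e by (intro exI[of _ "e / 2"]) auto
qed

text \<open>Since \<open>b\<^sub>n(x) / x = b\<^sub>n(y) / y\<close>, the distance of \<open>x\<close> and \<open>y\<close> is that of \<open>b\<^sub>n(x)\<close> and \<open>b\<^sub>n(y)\<close>. The latter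
  two are compared through the common value \<open>b\<^sub>n(x') = b\<^sub>n(y')\<close> by the Lipschitz bound.\<close>

lemma zeros_off_support_close:
  assumes u: "\<forall>n\<ge>1. norm (u n) = 1" and n: "n \<ge> 1" and d: "d > 0"
    and far: "\<And>t. t \<in> {x, x', y, y'} \<Longrightarrow> AE z in M. d \<le> norm (z - t)"
    and zeros: "x \<in> para_orth_zeros \<phi> u n" "y \<in> para_orth_zeros \<phi> u n"
      "x' \<in> para_orth_zeros \<phi> u (n + 1)" "y' \<in> para_orth_zeros \<phi> u (n + 1)"
  shows "norm (x - y) \<le> 4 / d\<^sup>2 * (norm (x - x') + norm (y - y'))"
proof -
  obtain m where m: "n = Suc m"
    using n by (cases n) auto
  have un: "norm (u n) = 1" "norm (u (Suc n)) = 1"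
    using u n by auto
  have z: "poly (para m (u n)) x = 0" "poly (para m (u n)) y = 0"
    "poly (para n (u (Suc n))) x' = 0" "poly (para n (u (Suc n))) y' = 0"
    using zeros m by (simp_all add: para_orth_zeros_def para_orth_poly_Suc)
  have circle: "norm x = 1" "norm y = 1" "norm x' = 1" "norm y' = 1"
    using z un norm_para_zero by blast+
  have "phase m x = phase m y"
    using z circle by (simp add: poly_para_eq_0_iff)
  then have "phase n x * y = phase n y * x"
    using phase_Suc_eq circle m by blast
  moreover have "phase n x' = phase n y'"
    using z circle by (simp add: poly_para_eq_0_iff)
  ultimately have "phase n x * (y - x) = x * ((phase n y - phase n y') - (phase n x - phase n x'))"
    by (simp add: algebra_simps)
  then have "norm (phase n x * (y - x)) = norm (x * ((phase n y - phase n y') - (phase n x - phase n x')))"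
    by simp
  then have "norm (x - y) = norm ((phase n y - phase n y') - (phase n x - phase n x'))"
    using circle by (simp add: norm_mult norm_phase norm_minus_commute)
  also have "\<dots> \<le> norm (phase n y - phase n y') + norm (phase n x - phase n x')"
    by (rule norm_triangle_ineq4)
  also have "\<dots> \<le> 4 / d\<^sup>2 * norm (y - y') + 4 / d\<^sup>2 * norm (x - x')"
    using far circle d by (intro add_mono phase_Lipschitz_off_support) auto
  finally show ?thesis
    by (simp add: algebra_simps add_divide_distrib)
qed

lemma exists_near_if_infdist_less:
  assumes "infdist x A < e" and "A \<noteq> {}"
  shows "\<exists>a\<in>A. dist x a < e"
  using assms by (simp add: infdist_def cINF_less_iff)

lemma para_orth_zeros_circle:
  assumes "\<forall>n\<ge>1. norm (u n) = 1" and "n \<ge> 1" and "z \<in> para_orth_zeros \<phi> u n"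
  shows "norm z = 1"
  using assms norm_para_zero[of "u n" "n - 1" z] para_orth_poly_Suc[of "n - 1" "u n"]
  by (simp add: para_orth_zeros_def)

text \<open>A strong limit point has zeros nearby at all large levels, in particular at the consecutive pairs of
  levels that serve the double limit point.\<close>

lemma strong_limit_eq_double_limit_off_support:
  assumes u: "\<forall>n\<ge>1. norm (u n) = 1"
    and w: "w \<in> strong_limit_points (para_orth_zeros \<phi> u)" "w \<notin> measure_supp M"
    and v: "v \<in> double_limit_points (para_orth_zeros \<phi> u)" "v \<notin> measure_supp M"
  shows "v = w"
proof -
  let ?E = "para_orth_zeros \<phi> u"
  have ne: "?E n \<noteq> {}" for n
    by (rule para_orth_zeros_nonempty[OF orthonormal])
  obtain I :: "nat set" where I: "infinite I"
    and lim: "((\<lambda>n. infdist v (?E n)) \<longlongrightarrow> 0) (inf sequentially (principal I))"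
      "((\<lambda>n. infdist v (?E (n + 1))) \<longlongrightarrow> 0) (inf sequentially (principal I))"
    using v by (auto simp: double_limit_points_def)
  have limw: "(\<lambda>n. infdist w (?E n)) \<longlonglongrightarrow> 0"
    using w by (simp add: strong_limit_points_def)
  have near: "\<exists>n x x' y y'. n \<ge> 1 \<and> x \<in> ?E n \<and> y \<in> ?E n \<and> x' \<in> ?E (n + 1) \<and> y' \<in> ?E (n + 1) \<and>
      dist v x < \<eta> \<and> dist v x' < \<eta> \<and> dist w y < \<eta> \<and> dist w y' < \<eta>" if \<eta>: "\<eta> > 0" for \<eta>
  proof -
    have "\<forall>\<^sub>F n in sequentially. n \<in> I \<longrightarrow> infdist v (?E n) < \<eta>"
      using order_tendstoD(2)[OF lim(1) \<eta>] by (simp add: eventually_inf_principal)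
    moreover have "\<forall>\<^sub>F n in sequentially. n \<in> I \<longrightarrow> infdist v (?E (n + 1)) < \<eta>"
      using order_tendstoD(2)[OF lim(2) \<eta>] by (simp add: eventually_inf_principal)
    moreover have "\<forall>\<^sub>F n in sequentially. infdist w (?E n) < \<eta>"
      using order_tendstoD(2)[OF limw \<eta>] .
    moreover have "\<forall>\<^sub>F n in sequentially. infdist w (?E (n + 1)) < \<eta>"
      using order_tendstoD(2)[OF LIMSEQ_ignore_initial_segment[OF limw, of 1] \<eta>] .
    ultimately have "\<forall>\<^sub>F n in sequentially. n \<in> I \<longrightarrow> n \<ge> 1 \<and> infdist v (?E n) < \<eta> \<and>
        infdist v (?E (n + 1)) < \<eta> \<and> infdist w (?E n) < \<eta> \<and> infdist w (?E (n + 1)) < \<eta>"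
      using eventually_ge_at_top[of 1] by eventually_elim blast
    then obtain N where N: "\<And>n. n \<ge> N \<Longrightarrow> n \<in> I \<Longrightarrow> n \<ge> 1 \<and> infdist v (?E n) < \<eta> \<and>
        infdist v (?E (n + 1)) < \<eta> \<and> infdist w (?E n) < \<eta> \<and> infdist w (?E (n + 1)) < \<eta>"
      by (auto simp: eventually_sequentially)
    obtain n where "n \<ge> N" "n \<in> I"
      using I by (meson infinite_nat_iff_unbounded_le)
    from N[OF this] show ?thesis
      using exists_near_if_infdist_less[OF _ ne] by meson
  qed
  have circle: "norm t = 1" if "\<And>\<eta>. \<eta> > 0 \<Longrightarrow> \<exists>x. norm x = 1 \<and> dist t x < \<eta>" for t :: complex
  proof -
    have "t \<in> closure (sphere 0 1)"
      unfolding closure_approachable using that by (force simp: dist_commute)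
    then show ?thesis by simp
  qed
  have "norm v = 1"
    by (rule circle) (use near para_orth_zeros_circle[OF u] in blast)
  then obtain d1 where d1: "d1 > 0" "\<And>x. dist x v < d1 \<Longrightarrow> AE z in M. d1 \<le> norm (z - x)"
    using off_support_gap v by blast
  have "norm w = 1"
    by (rule circle) (use near para_orth_zeros_circle[OF u] in blast)
  then obtain d2 where d2: "d2 > 0" "\<And>x. dist x w < d2 \<Longrightarrow> AE z in M. d2 \<le> norm (z - x)"
    using off_support_gap w by blast
  define d where "d = min d1 d2"
  have d: "d > 0"
    using d1 d2 by (simp add: d_def)
  have gap: "AE z in M. d \<le> norm (z - x)" if "dist v x < d \<or> dist w x < d" for x
  proof (cases "dist v x < d")
    case True
    then have "AE z in M. d1 \<le> norm (z - x)"
      by (intro d1) (auto simp: d_def dist_commute)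
    then show ?thesis by eventually_elim (simp add: d_def)
  next
    case False
    then have "AE z in M. d2 \<le> norm (z - x)"
      using that by (intro d2) (auto simp: d_def dist_commute)
    then show ?thesis by eventually_elim (simp add: d_def)
  qed
  \<comment> \<open>If \<open>x, x'\<close> are within \<open>\<eta>\<close> of \<open>v\<close> and \<open>y, y'\<close> within \<open>\<eta>\<close> of \<open>w\<close>, then \<open>dist x x' + dist y y' \<le> 4 \<eta>\<close>. The
     Lipschitz constant turns this into \<open>16 \<eta> / d\<^sup>2\<close>, and the passage from \<open>x, y\<close> to \<open>v, w\<close> costs \<open>2 \<eta>\<close>.\<close>
  define K where "K = 2 + 16 / d\<^sup>2"
  have K: "K > 0"
    using d by (simp add: K_def add_pos_nonneg)
  have bound: "dist v w \<le> K * \<eta>" if \<eta>: "0 < \<eta>" "\<eta> \<le> d" for \<eta>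
  proof -
    obtain n x x' y y' where n: "n \<ge> 1"
      and zeros: "x \<in> ?E n" "y \<in> ?E n" "x' \<in> ?E (n + 1)" "y' \<in> ?E (n + 1)"
      and close: "dist v x < \<eta>" "dist v x' < \<eta>" "dist w y < \<eta>" "dist w y' < \<eta>"
      using near[OF \<eta>(1)] by blast
    have "AE z in M. d \<le> norm (z - t)" if "t \<in> {x, x', y, y'}" for t
      using that close \<eta>(2) by (intro gap) auto
    from zeros_off_support_close[OF u n d this zeros]
    have "dist x y \<le> 4 / d\<^sup>2 * (dist x x' + dist y y')"
      by (simp add: dist_norm)
    also have "\<dots> \<le> 4 / d\<^sup>2 * (4 * \<eta>)"
    proof (rule mult_left_mono)
      show "dist x x' + dist y y' \<le> 4 * \<eta>"
        using close dist_triangle3[of x x' v] dist_triangle3[of y y' w] by linarith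
    qed simp
    finally have "dist x y \<le> 16 / d\<^sup>2 * \<eta>" by simp
    moreover have "dist v w \<le> dist v x + dist x y + dist w y"
      using dist_triangle[of v w x] dist_triangle[of x w y] by (simp add: dist_commute)
    ultimately show ?thesis
      using close by (simp add: K_def algebra_simps)
  qed
  show ?thesis
  proof (rule ccontr)
    assume "v \<noteq> w"
    then have pos: "dist v w > 0" by simp
    define \<eta> where "\<eta> = min d (dist v w / (2 * K))"
    have "dist v w \<le> K * \<eta>"
      by (rule bound) (use d K pos in \<open>auto simp: \<eta>_def\<close>)
    also have "\<dots> \<le> K * (dist v w / (2 * K))"
      using K by (intro mult_left_mono) (auto simp: \<eta>_def)
    also have "\<dots> = dist v w / 2"
      using K by simp
    finally show False using pos by simp
  qed
qed

end

lemma strong_limit_points_subset_double_limit_points: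
  "strong_limit_points E \<subseteq> double_limit_points E"
proof
  fix x assume "x \<in> strong_limit_points E"
  then have lim: "(\<lambda>n. infdist x (E n)) \<longlonglongrightarrow> 0"
    by (simp add: strong_limit_points_def)
  from LIMSEQ_ignore_initial_segment[OF this, of 1] lim
  show "x \<in> double_limit_points E"
    unfolding double_limit_points_def by (auto intro!: exI[of _ UNIV])
qed

theorem theorem4p17:
  fixes M :: "complex measure"
    and \<phi> :: "nat \<Rightarrow> complex poly"
    and a u :: "nat \<Rightarrow> complex"
  assumes "prob_on_circle M"
    and "infinite (measure_supp M)"
    and "orthonormal_polys M \<phi>"
    and "schur_parameters \<phi> a"
    and "\<forall>n\<ge>1. norm (u n) = 1"
  shows "measure_supp M \<subseteq> strong_limit_points (para_orth_zeros \<phi> u) \<and>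
    (\<exists>w. strong_limit_points (para_orth_zeros \<phi> u) - measure_supp M \<subseteq> {w}) \<and>
    (\<forall>w \<in> strong_limit_points (para_orth_zeros \<phi> u) - measure_supp M.
       double_limit_points (para_orth_zeros \<phi> u) = strong_limit_points (para_orth_zeros \<phi> u) \<and>
       double_limit_points (para_orth_zeros \<phi> u) = insert w (measure_supp M))"
proof -
  interpret opuc M \<phi>
    using assms by unfold_locales
  let ?S = "strong_limit_points (para_orth_zeros \<phi> u)"
  let ?D = "double_limit_points (para_orth_zeros \<phi> u)"
  have supp: "measure_supp M \<subseteq> ?S"
    using support_subset_strong_limit assms(5) by blast
  have sub: "?S \<subseteq> ?D"
    by (rule strong_limit_points_subset_double_limit_points)
  have unique: "v = w" if "w \<in> ?S - measure_supp M" "v \<in> ?D - measure_supp M" for v w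
    using strong_limit_eq_double_limit_off_support[OF assms(5)] that by blast
  have "\<exists>w. ?S - measure_supp M \<subseteq> {w}"
    using unique sub by (cases "?S - measure_supp M = {}") (auto, blast)
  moreover have "?D = ?S \<and> ?D = insert w (measure_supp M)" if "w \<in> ?S - measure_supp M" for w
    using unique[OF that] that sub supp by blast
  ultimately show ?thesis
    using supp by blast
qed

end
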